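(* Let $G=(V,E)$ be a connected graph on $n$ nodes and let $r\ge1$ be an integer with $r\le\delta(G)$. (i) If $r=1$, then $\overleftarrow{MI}_r(G)=1$. (ii) If $r=2$, then $2\le \overleftarrow{MI}_r(G)\le \frac{n}{1+x}$, where $x=0$ if $n$ is odd and $x=1$ if $n$ is even. (iii) If $r\ge3$, then $r\le \overleftarrow{MI}_r(G)\le n$.
   Context: $\delta(G)$ is the minimum degree of $G$. A configuration is a map $\mathcal{C}:V\to\{b,w\}$ (black/white). In two-way $r$-bootstrap percolation, starting from $\mathcal{C}_0$, in each round $t\ge1$ all nodes update simultaneously: $\mathcal{C}_t(v)=b$ if $v$ has at least $r$ neighbors that are black in $\mathcal{C}_{t-1}$, and $\mathcal{C}_t(v)=w$ otherwise. A set $I\subseteq V$ is an immortal set if for every initial configuration in which all nodes of $I$ are black, in every round $t'\ge0$ at least one node of $V$ is black. $\overleftarrow{MI}_r(G)$ denotes the minimum size of an immortal set in two-way $r$-bootstrap percolation on $G$. Standing assumptions: $r\le\delta(G)$, and $r$ is fixed while $n\to\infty$. *)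

theory Defs
  imports Complex_Main "Graph_Theory.Digraph_Component"
begin

text \<open>
  A finite simple undirected graph is a digraph satisfying the locale predicate \<open>graph\<close>
  (finite, loop-free, no parallel arcs, symmetric): an edge \<open>{u, v}\<close> is represented by the two
  opposite arcs between \<open>u\<close> and \<open>v\<close>, so that the degree of a vertex is its out-degree.
\<close>

definition min_degree :: "('a, 'b) pre_digraph \<Rightarrow> nat" where
  "min_degree G = Min (out_degree G ` verts G)"

definition neighbors :: "('a, 'b) pre_digraph \<Rightarrow> 'a \<Rightarrow> 'a set" where
  "neighbors G v = {u. v \<rightarrow>\<^bsub>G\<^esub> u}"

text \<open>
  Configurations are total functions on the vertex type. Colours outside \<open>verts G\<close> are
  irrelevant, since all neighbours lie in \<open>verts G\<close>.
\<close>

datatype colour = Black | White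

type_synonym 'a config = "'a \<Rightarrow> colour"

definition two_way_step :: "nat \<Rightarrow> ('a, 'b) pre_digraph \<Rightarrow> 'a config \<Rightarrow> 'a config" where
  "two_way_step r G C v =
     (if r \<le> card {u \<in> neighbors G v. C u = Black} then Black else White)"

definition two_way_config :: "nat \<Rightarrow> ('a, 'b) pre_digraph \<Rightarrow> 'a config \<Rightarrow> nat \<Rightarrow> 'a config" where
  "two_way_config r G C t = (two_way_step r G ^^ t) C"

definition immortal_set :: "nat \<Rightarrow> ('a, 'b) pre_digraph \<Rightarrow> 'a set \<Rightarrow> bool" where
  "immortal_set r G I \<longleftrightarrow> I \<subseteq> verts G \<and>
     (\<forall>C. (\<forall>v\<in>I. C v = Black) \<longrightarrow> (\<forall>t. \<exists>v\<in>verts G. two_way_config r G C t v = Black))"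

text \<open>
  If \<open>1 \<le> r \<le> min_degree G\<close> and \<open>G\<close> is a nonempty finite graph, then \<open>verts G\<close> itself is
  immortal, so the minimum is taken over a nonempty finite set.
\<close>

definition MI :: "nat \<Rightarrow> ('a, 'b) pre_digraph \<Rightarrow> nat" where
  "MI r G = Min (card ` {I. immortal_set r G I})"

end

theory Submission
  imports Defs
begin

text \<open>
  A configuration with fewer than \<open>r\<close> black vertices dies in one round. Conversely, if every vertex of \<open>S\<close> has \<open>r\<close> neighbours in \<open>T\<close> and vice versa, then \<open>S\<close> is
  immortal. For \<open>r = 2\<close> this applies to the vertices of any cycle, and to every second vertex of
  an even cycle. So for even \<open>n\<close> it suffices to find an even cycle or an odd one of length at most
  \<open>n / 2\<close>. Take a longest path \<open>p\<^sub>0, \<dots>, p\<^sub>k\<close>; its ends have chords to \<open>p\<^sub>i\<close> and \<open>p\<^sub>j\<close>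
  respectively. If \<open>i \<le> j\<close>, the two resulting cycles share at most one vertex, so one has length at
  most \<open>(n + 1) / 2\<close>, hence at most \<open>n / 2\<close>. If \<open>j < i\<close> and both are odd, the cycle
  \<open>p\<^sub>0, \<dots>, p\<^sub>j, p\<^sub>k, \<dots>, p\<^sub>i\<close> is even, unless both chords are the edge \<open>p\<^sub>0 p\<^sub>k\<close>; then the
  closed longest path covers the connected graph and has even length \<open>n\<close>.
\<close>

context graph
begin

section \<open>Neighbourhoods and connectivity\<close>

lemma neighbors_sym: "u \<in> neighbors G v \<Longrightarrow> v \<in> neighbors G u"
  unfolding neighbors_def using symmetric_conv sym_arcs
  by (auto simp: symmetric_def sym_def)

lemma neighbors_subset_verts: "neighbors G v \<subseteq> verts G"
  unfolding neighbors_def using adj_in_verts by auto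

lemma finite_neighbors: "finite (neighbors G v)"
  using finite_subset[OF neighbors_subset_verts] finite_verts by blast

text \<open>Without parallel arcs the head determines an arc leaving \<open>v\<close>, so counting
  arcs counts neighbours.\<close>

lemma card_neighbors: "card (neighbors G v) = out_degree G v"
proof -
  have "inj_on (head G) (out_arcs G v)"
    by (auto intro!: inj_onI no_multi_arcs simp: arc_to_ends_def)
  moreover have "neighbors G v = head G ` out_arcs G v"
    by (auto simp: neighbors_def arcs_ends_def arc_to_ends_def)
  ultimately show ?thesis
    by (simp add: out_degree_def card_image)
qed

lemma min_degree_le_card_neighbors:
  "v \<in> verts G \<Longrightarrow> min_degree G \<le> card (neighbors G v)"
  unfolding card_neighbors min_degree_def by simp

lemma connected_closed_set_eq_verts:
  assumes conn: "Digraph_Component.connected G" and S: "S \<subseteq> verts G" "S \<noteq> {}"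
    and closed: "\<And>v. v \<in> S \<Longrightarrow> neighbors G v \<subseteq> S"
  shows "S = verts G"
proof -
  obtain u where u: "u \<in> S" using S by blast
  have "w \<in> S" if "w \<in> verts G" for w
  proof -
    \<comment> \<open>\<open>connected\<close> refers to the symmetrised digraph; \<open>G\<close>
      is symmetric, so reachability there is reachability in \<open>G\<close>.\<close>
    have "u \<rightarrow>\<^sup>*\<^bsub>G\<^esub> w"
      using conn that u S reachable_mk_symmetric_eq[OF sym_arcs]
      by (auto simp: connected_def strongly_connected_def)
    then show ?thesis
      using u closed by (induction rule: reachable_induct) (auto simp: neighbors_def)
  qed
  then show ?thesis using S by blast
qed

section \<open>Immortal sets and bounds on \<open>MI\<close>\<close>

text \<open>By induction \<open>S\<close> is all black in even rounds and \<open>T\<close> in odd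
  ones.\<close>

lemma immortal_setI:
  assumes "S \<subseteq> verts G" "T \<subseteq> verts G" "S \<noteq> {}" "T \<noteq> {}"
    and ST: "\<And>v. v \<in> S \<Longrightarrow> r \<le> card (neighbors G v \<inter> T)"
    and TS: "\<And>v. v \<in> T \<Longrightarrow> r \<le> card (neighbors G v \<inter> S)"
  shows "immortal_set r G S"
proof -
  have step: "two_way_step r G C v = Black"
    if "r \<le> card (neighbors G v \<inter> A)" "\<forall>u\<in>A. C u = Black" for C :: "'a config" and A v
  proof -
    have "neighbors G v \<inter> A \<subseteq> {u \<in> neighbors G v. C u = Black}" using that by blast
    from card_mono[OF _ this] show ?thesis
      using that finite_neighbors by (simp add: two_way_step_def)
  qed
  have "\<forall>v \<in> (if even t then S else T). two_way_config r G C t v = Black"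
    if "\<forall>v\<in>S. C v = Black" for C :: "'a config" and t
  proof (induction t)
    case 0
    then show ?case using that by (simp add: two_way_config_def)
  next
    case (Suc t)
    then show ?case
      using step[of _ "if even t then S else T" "two_way_config r G C t"] ST TS
      by (auto simp: two_way_config_def)
  qed
  with assms(1-4) show ?thesis
    unfolding immortal_set_def by (smt (verit) ex_in_conv subsetD)
qed

lemma finite_immortal_sets: "finite {I. immortal_set r G I}"
  by (rule finite_subset[of _ "Pow (verts G)"]) (auto simp: immortal_set_def)

lemma MI_le_card: "immortal_set r G I \<Longrightarrow> MI r G \<le> card I"
  unfolding MI_def using finite_immortal_sets by simp

lemma immortal_set_card_ge:
  assumes "1 \<le> r" and I: "immortal_set r G I"
  shows "r \<le> card I"
proof (rule ccontr)
  assume "\<not> r \<le> card I"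
  \<comment> \<open>The worst extension of \<open>I\<close>: everything outside it is white.\<close>
  define C where "C = (\<lambda>v. if v \<in> I then Black else White)"
  have fin: "finite I" using I finite_subset[OF _ finite_verts] by (auto simp: immortal_set_def)
  have "two_way_step r G C v = White" for v
  proof -
    have "card {u \<in> neighbors G v. C u = Black} \<le> card I"
      by (rule card_mono[OF fin]) (auto simp: C_def split: if_splits)
    then show ?thesis using \<open>\<not> r \<le> card I\<close> by (simp add: two_way_step_def)
  qed
  then have "\<forall>v. two_way_config r G C 1 v \<noteq> Black" by (simp add: two_way_config_def)
  moreover have "\<forall>v\<in>I. C v = Black" by (simp add: C_def)
  ultimately show False using I unfolding immortal_set_def by blast
qed

text \<open>By the degree bound the vertices stay black forever; hence the minimum in
  \<open>MI\<close> is over a nonempty set.\<close>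

lemma verts_immortal:
  assumes "verts G \<noteq> {}" "r \<le> min_degree G"
  shows "immortal_set r G (verts G)"
proof (rule immortal_setI)
  fix v assume "v \<in> verts G"
  then show "r \<le> card (neighbors G v \<inter> verts G)"
    using min_degree_le_card_neighbors neighbors_subset_verts assms
    by (metis inf.absorb1 le_trans)
  then show "r \<le> card (neighbors G v \<inter> verts G)" .
qed (use assms in auto)

lemma MI_ge:
  assumes "verts G \<noteq> {}" "1 \<le> r" "r \<le> min_degree G"
  shows "r \<le> MI r G"
  unfolding MI_def
  using verts_immortal[OF assms(1,3)] immortal_set_card_ge[OF assms(2)] finite_immortal_sets
  by (subst Min_ge_iff) auto

section \<open>Cycles\<close>

text \<open>The bound \<open>3 \<le> m\<close> excludes an edge run back and forth, so predecessor
  and successor on the cycle differ.\<close>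

definition cycle_map :: "nat \<Rightarrow> (nat \<Rightarrow> 'a) \<Rightarrow> bool" where
  "cycle_map m c \<longleftrightarrow> 3 \<le> m \<and> inj_on c {..<m} \<and>
     (\<forall>t. Suc t < m \<longrightarrow> c (Suc t) \<in> neighbors G (c t)) \<and> c 0 \<in> neighbors G (c (m - 1))"

lemma cycle_map_le_card_verts:
  assumes "cycle_map m c"
  shows "c ` {..<m} \<subseteq> verts G" "m \<le> card (verts G)"
proof -
  have "c t \<in> verts G" if "t < m" for t
    using assms that neighbors_subset_verts unfolding cycle_map_def
    by (cases t) auto
  then show sub: "c ` {..<m} \<subseteq> verts G" by blast
  from card_mono[OF _ sub] show "m \<le> card (verts G)"
    using assms by (simp add: cycle_map_def card_image)
qed

text \<open>Take the cyclic successor and predecessor of \<open>t\<close>. The wrap joins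
  \<open>0\<close> and \<open>m - 1\<close>, which differ in parity when \<open>m\<close> is
  even.\<close>

lemma cycle_map_two_neighbors:
  assumes c: "cycle_map m c" and t: "t < m"
  obtains a b where "a < m" "b < m" "a \<noteq> b" "c a \<in> neighbors G (c t)" "c b \<in> neighbors G (c t)"
    "even m \<Longrightarrow> even a \<noteq> even t" "even m \<Longrightarrow> even b \<noteq> even t"
proof -
  define a where "a = (if Suc t = m then 0 else Suc t)"
  define b where "b = (if t = 0 then m - 1 else t - 1)"
  have "3 \<le> m" using c by (simp add: cycle_map_def)
  have "c a \<in> neighbors G (c t)"
    using c t by (auto simp: cycle_map_def a_def)
  moreover have "c b \<in> neighbors G (c t)"
    using c t by (cases t) (auto simp: cycle_map_def b_def intro: neighbors_sym)
  moreover have "a < m" "b < m" "a \<noteq> b" "even m \<Longrightarrow> even a \<noteq> even t" "even m \<Longrightarrow> even b \<noteq> even t"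
    using t \<open>3 \<le> m\<close> by (auto simp: a_def b_def)
  ultimately show ?thesis using that by blast
qed

lemma two_le_card_neighbors_Int:
  assumes "cycle_map m c" "a < m" "b < m" "a \<noteq> b"
    "c a \<in> neighbors G v \<inter> A" "c b \<in> neighbors G v \<inter> A"
  shows "2 \<le> card (neighbors G v \<inter> A)"
proof -
  have "c a \<noteq> c b" using assms by (auto simp: cycle_map_def inj_on_def)
  then have "card {c a, c b} = 2" by simp
  then show ?thesis
    using card_mono[of "neighbors G v \<inter> A" "{c a, c b}"] assms finite_neighbors by auto
qed

lemma MI_2_le_cycle_length:
  assumes c: "cycle_map m c"
  shows "MI 2 G \<le> m"
proof -
  have "immortal_set 2 G (c ` {..<m})"
  proof (rule immortal_setI)
    fix v assume "v \<in> c ` {..<m}"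
    then obtain t where t: "t < m" "v = c t" by blast
    show "2 \<le> card (neighbors G v \<inter> c ` {..<m})"
      using cycle_map_two_neighbors[OF c t(1)] two_le_card_neighbors_Int[OF c] t
      by (metis IntI imageI lessThan_iff)
    \<comment> \<open>Here \<open>T = S\<close>, so the two conditions coincide.\<close>
    then show "2 \<le> card (neighbors G v \<inter> c ` {..<m})" .
  qed (use c cycle_map_le_card_verts[OF c] in \<open>auto simp: cycle_map_def lessThan_empty_iff\<close>)
  then show ?thesis
    using MI_le_card card_image_le[of "{..<m}" c] by fastforce
qed

text \<open>On an even cycle the black colour may alternate between the two parity classes.\<close>

lemma MI_2_le_half_even_cycle_length:
  assumes c: "cycle_map m c" and "even m"
  shows "2 * MI 2 G \<le> m"
proof -
  define S where "S p = c ` {t. t < m \<and> even t = p}" for p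
  have nb: "2 \<le> card (neighbors G v \<inter> S (\<not> p))" if "v \<in> S p" for v p
  proof -
    obtain t where t: "t < m" "even t = p" "v = c t" using \<open>v \<in> S p\<close> by (auto simp: S_def)
    obtain a b where ab: "a < m" "b < m" "a \<noteq> b"
      "c a \<in> neighbors G (c t)" "c b \<in> neighbors G (c t)" "even a \<noteq> even t" "even b \<noteq> even t"
      using cycle_map_two_neighbors[OF c t(1)] \<open>even m\<close> by metis
    then have "c a \<in> S (\<not> p)" "c b \<in> S (\<not> p)" using t by (auto simp: S_def)
    then show ?thesis using two_le_card_neighbors_Int[OF c ab(1-3)] ab t by blast
  qed
  have "3 \<le> m" using c by (simp add: cycle_map_def)
  then have "c 0 \<in> S True" "c 1 \<in> S False" by (auto simp: S_def)
  moreover have "S p \<subseteq> verts G" for p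
    using cycle_map_le_card_verts(1)[OF c] by (auto simp: S_def)
  ultimately have "immortal_set 2 G (S True)"
    using nb[of _ True] nb[of _ False] by (intro immortal_setI[of _ "S False"]) auto
  then have "MI 2 G \<le> card (S True)" by (rule MI_le_card)
  also have "\<dots> \<le> card {t. t < m \<and> even t}"
    unfolding S_def by (simp add: card_image_le)
  also have "{t. t < m \<and> even t} \<subseteq> (\<lambda>t. 2 * t) ` {..<m div 2}"
    using \<open>even m\<close> by (auto elim!: evenE)
  then have "card {t. t < m \<and> even t} \<le> card {..<m div 2}"
    by (meson card_image_le card_mono finite_imageI finite_lessThan le_trans)
  finally show ?thesis using \<open>even m\<close> by simp
qed

section \<open>Longest paths\<close>

text \<open>\<open>k\<close> counts edges. For \<open>k = 0\<close> no edge forces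
  \<open>p 0\<close> to be a vertex, hence the explicit inclusion.\<close>

definition path_map :: "nat \<Rightarrow> (nat \<Rightarrow> 'a) \<Rightarrow> bool" where
  "path_map k p \<longleftrightarrow> inj_on p {..k} \<and> p ` {..k} \<subseteq> verts G \<and>
     (\<forall>t<k. p (Suc t) \<in> neighbors G (p t))"

lemma path_map_eq_iff:
  "path_map k p \<Longrightarrow> s \<le> k \<Longrightarrow> t \<le> k \<Longrightarrow> p s = p t \<longleftrightarrow> s = t"
  by (auto simp: path_map_def inj_on_def)

lemma path_map_rev:
  assumes "path_map k p"
  shows "path_map k (\<lambda>t. p (k - t))"
proof -
  have "p (k - Suc t) \<in> neighbors G (p (k - t))" if "t < k" for t
  proof -
    have "p (Suc (k - Suc t)) \<in> neighbors G (p (k - Suc t))"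
      using assms that by (simp add: path_map_def)
    then show ?thesis using that by (auto intro: neighbors_sym simp: Suc_diff_Suc)
  qed
  moreover have "inj_on (\<lambda>t. p (k - t)) {..k}"
    by (auto simp: inj_on_def path_map_eq_iff[OF assms])
  ultimately show ?thesis
    using assms by (auto simp: path_map_def)
qed

lemma path_map_extend:
  assumes "path_map k p" "u \<in> neighbors G (p k)" "u \<notin> p ` {..k}"
  shows "path_map (Suc k) (p(Suc k := u))"
proof -
  have "u \<in> verts G" using assms neighbors_subset_verts by blast
  then show ?thesis
    using assms by (auto simp: path_map_def inj_on_def less_Suc_eq atMost_Suc)
qed

lemma longest_path_map:
  assumes "verts G \<noteq> {}"
  obtains k p where "path_map k p" "\<And>q. \<not> path_map (Suc k) q"
proof -
  have bound: "k \<le> card (verts G)" if "\<exists>p. path_map k p" for k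
  proof -
    from that obtain p where "path_map k p" ..
    then have "card {..k} \<le> card (verts G)"
      by (intro card_inj_on_le[of p]) (auto simp: path_map_def)
    then show ?thesis by simp
  qed
  obtain v where "v \<in> verts G" using assms by blast
  then have ex: "\<exists>p. path_map 0 p" by (intro exI[of _ "\<lambda>_. v"]) (simp add: path_map_def)
  let ?k = "GREATEST k. \<exists>p. path_map k p"
  have "\<exists>p. path_map ?k p" by (rule GreatestI_nat[where P = "\<lambda>k. \<exists>p. path_map k p", OF ex bound])
  moreover have "\<not> path_map (Suc ?k) q" for q
    using Greatest_le_nat[of "\<lambda>k. \<exists>p. path_map k p" "Suc ?k", OF _ bound] by auto
  ultimately show ?thesis using that by blast
qed

text \<open>By maximality all neighbours of \<open>p k\<close> lie on the path, and by degree one of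
  them is not its predecessor.\<close>

lemma path_map_end_chord:
  assumes p: "path_map k p" and longest: "\<And>q. \<not> path_map (Suc k) q" and deg: "2 \<le> min_degree G"
  obtains j where "j + 2 \<le> k" "p j \<in> neighbors G (p k)"
proof -
  have sub: "neighbors G (p k) \<subseteq> p ` {..k}"
    using path_map_extend[OF p] longest by blast
  have "p k \<in> verts G" using p by (auto simp: path_map_def)
  then have "2 \<le> card (neighbors G (p k))"
    using min_degree_le_card_neighbors deg le_trans by blast
  then have "\<not> neighbors G (p k) \<subseteq> {p (k - 1)}"
    by (metis One_nat_def card.empty card.insert card_mono empty_iff finite.emptyI
        finite.insertI le_trans not_less_eq_eq numeral_2_eq_2 order_refl)
  then obtain u where u: "u \<in> neighbors G (p k)" "u \<noteq> p (k - 1)" by blast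
  obtain j where j: "j \<le> k" "u = p j" using u sub by blast
  have "p k \<notin> neighbors G (p k)"
    using adj_not_same by (auto simp: neighbors_def)
  \<comment> \<open>For \<open>k = 0\<close> this contradicts \<open>j \<le> k\<close>, so the
    one-vertex path is excluded too.\<close>
  then have "j \<noteq> k" "j \<noteq> k - 1" using u j by auto
  then show ?thesis using that[of j] u j by force
qed

lemma cycle_map_path_segment:
  assumes p: "path_map k p" and "i + 2 \<le> j" "j \<le> k" and chord: "p j \<in> neighbors G (p i)"
  shows "cycle_map (j - i + 1) (\<lambda>t. p (i + t))"
proof -
  have "inj_on (\<lambda>t. p (i + t)) {..<j - i + 1}"
    using assms(2,3) by (auto simp: inj_on_def path_map_eq_iff[OF p])
  then show ?thesis
    using p assms neighbors_sym[OF chord] by (auto simp: path_map_def cycle_map_def)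
qed

text \<open>Rotating the cycle lets any edge leaving it extend a path through all its vertices.\<close>

lemma longest_path_closed_spans:
  assumes conn: "Digraph_Component.connected G"
    and p: "path_map k p" and longest: "\<And>q. \<not> path_map (Suc k) q"
    and chord: "p 0 \<in> neighbors G (p k)"
  shows "p ` {..k} = verts G"
proof (rule connected_closed_set_eq_verts[OF conn])
  show "p ` {..k} \<subseteq> verts G" "p ` {..k} \<noteq> {}" using p by (auto simp: path_map_def)
  fix v assume "v \<in> p ` {..k}"
  then obtain a where a: "a \<le> k" "v = p a" by blast
  \<comment> \<open>\<open>q\<close> runs through \<open>p (a + 1), ..., p k, p 0, ..., p a\<close>:
    indices modulo \<open>k + 1\<close>, ending in \<open>v\<close>.\<close>
  define q where "q t = (if a + 1 + t \<le> k then p (a + 1 + t) else p (a + t - k))" for t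
  have img: "q ` {..k} \<subseteq> p ` {..k}" using a by (auto simp: q_def)
  have inj: "inj_on q {..k}"
  proof (rule inj_onI)
    fix s t assume st: "s \<in> {..k}" "t \<in> {..k}" "q s = q t"
    show "s = t"
      using st a by (auto simp: q_def path_map_eq_iff[OF p] split: if_splits)
  qed
  have edge: "q (Suc t) \<in> neighbors G (q t)" if "t < k" for t
  proof -
    consider "a + 1 + Suc t \<le> k" | "a + 1 + t = k" | "k < a + 1 + t" by linarith
    then show ?thesis
    proof cases
      case 3
      then have "a + Suc t - k = Suc (a + t - k)" by simp
      then show ?thesis using 3 that a p by (auto simp: q_def path_map_def)
    qed (use p chord in \<open>auto simp: q_def path_map_def\<close>)
  qed
  have "path_map k q"
    using inj img edge p unfolding path_map_def by blast
  moreover have "q k = v" using a by (simp add: q_def)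
  ultimately have "neighbors G v \<subseteq> q ` {..k}"
    using path_map_extend longest by blast
  then show "neighbors G v \<subseteq> p ` {..k}" using img by blast
qed

section \<open>Even order for \<open>r = 2\<close>, and the remaining cases\<close>

lemma MI_2_le_half_even:
  assumes conn: "Digraph_Component.connected G" and ne: "verts G \<noteq> {}"
    and deg: "2 \<le> min_degree G" and even: "even (card (verts G))"
  shows "2 * MI 2 G \<le> card (verts G)"
proof (rule ccontr)
  assume contra: "\<not> ?thesis"
  \<comment> \<open>In a counterexample every cycle is odd and longer than half the order.\<close>
  have odd_cycle: "odd m \<and> card (verts G) < 2 * m" if "cycle_map m c" for m c
    using MI_2_le_cycle_length[OF that] MI_2_le_half_even_cycle_length[OF that]
      cycle_map_le_card_verts(2)[OF that] contra by linarith
  obtain k p where p: "path_map k p" and longest: "\<And>q. \<not> path_map (Suc k) q"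
    using longest_path_map[OF ne] by blast
  obtain j where j: "j + 2 \<le> k" "p j \<in> neighbors G (p k)"
    using path_map_end_chord[OF p longest deg] .
  \<comment> \<open>\<open>p 0\<close> ends the reversed path, so \<open>i'\<close> counts backwards
    from \<open>p k\<close>.\<close>
  obtain i' where i': "i' + 2 \<le> k" "p (k - i') \<in> neighbors G (p 0)"
    using path_map_end_chord[OF path_map_rev[OF p] longest deg] by auto
  define i where "i = k - i'"
  have i: "2 \<le> i" "i \<le> k" "p i \<in> neighbors G (p 0)" using i' by (auto simp: i_def)
  have ci: "odd (i + 1)" "card (verts G) < 2 * (i + 1)"
    using odd_cycle[OF cycle_map_path_segment[OF p, of 0 i]] i by auto
  have cj: "odd (k - j + 1)" "card (verts G) < 2 * (k - j + 1)"
    using odd_cycle[OF cycle_map_path_segment[OF p, of j k]] j neighbors_sym by auto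
  have "card (p ` {..k}) = k + 1" using p by (simp add: path_map_def card_image)
  then have kn: "k + 1 \<le> card (verts G)"
    using card_mono[of "verts G" "p ` {..k}"] p by (auto simp: path_map_def)
  consider "i \<le> j" | "i = k" "j = 0" | "j < i" "i \<noteq> k \<or> j \<noteq> 0" by linarith
  then show False
  proof cases
    case 1
    \<comment> \<open>With order \<open>2 * h\<close>, both lengths are at least
      \<open>h + 1\<close>, but their sum is at most \<open>k + 2 \<le> 2 * h + 1\<close>.\<close>
    obtain h where "card (verts G) = 2 * h" using even by (rule evenE)
    then show False using 1 ci(2) cj(2) kn j by arith
  next
    case 2
    \<comment> \<open>The closed path spans \<open>G\<close>, so the order is \<open>i + 1\<close>,
      which is odd.\<close>
    then have "card (verts G) = k + 1"
      using longest_path_closed_spans[OF conn p longest] j \<open>card (p ` {..k}) = k + 1\<close> by simp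
    then show False using ci 2 even by simp
  next
    case 3
    \<comment> \<open>Follow \<open>p 0, ..., p j\<close>, jump to \<open>p k\<close>, descend to
      \<open>p i\<close> and return to \<open>p 0\<close>. The arcs have \<open>j + 1\<close> and
      \<open>k - i + 1\<close> vertices and are disjoint as \<open>j < i\<close>.\<close>
    define m where "m = j + k - i + 2"
    define c where "c t = (if t \<le> j then p t else p (k + j + 1 - t))" for t
    have "inj_on c {..<m}"
    proof (rule inj_onI)
      fix s t assume st: "s \<in> {..<m}" "t \<in> {..<m}" "c s = c t"
      show "s = t"
        using st 3 i j by (auto simp: c_def m_def path_map_eq_iff[OF p] split: if_splits)
    qed
    moreover have "c (Suc t) \<in> neighbors G (c t)" if "Suc t < m" for t
    proof -
      consider "t < j" | "t = j" | "j < t" by linarith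
      then show ?thesis
      proof cases
        case 1
        then show ?thesis using p j by (simp add: c_def path_map_def)
      next
        case 2
        then show ?thesis using j neighbors_sym by (simp add: c_def)
      next
        case t: 3
        have "Suc (k + j - t) = k + j + 1 - t" "k + j - t < k"
          using t that i by (auto simp: m_def)
        then have "p (k + j + 1 - t) \<in> neighbors G (p (k + j - t))"
          using p by (metis path_map_def)
        then show ?thesis using t neighbors_sym by (simp add: c_def)
      qed
    qed
    moreover have "c 0 \<in> neighbors G (c (m - 1))"
    proof -
      have "c (m - 1) = p i" using 3 i j by (auto simp: c_def m_def)
      then show ?thesis using i neighbors_sym by (simp add: c_def)
    qed
    \<comment> \<open>Only \<open>i = k\<close>, \<open>j = 0\<close> would give
      \<open>m = 2\<close>.\<close>
    moreover have "3 \<le> m" using 3 i by (auto simp: m_def)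
    ultimately have "cycle_map m c" unfolding cycle_map_def by blast
    then have "odd m" using odd_cycle by blast
    moreover have "even m"
    proof -
      have "even i" "even (k - j)" using ci cj by auto
      then show ?thesis using i j by (simp add: m_def)
    qed
    ultimately show False by simp
  qed
qed

text \<open>Black bounces back and forth along one edge.\<close>

lemma MI_1_eq_1:
  assumes "verts G \<noteq> {}" "1 \<le> min_degree G"
  shows "MI 1 G = 1"
proof -
  obtain v where v: "v \<in> verts G" using assms by blast
  then have "neighbors G v \<noteq> {}"
    using min_degree_le_card_neighbors[OF v] assms by auto
  then obtain u where u: "u \<in> neighbors G v" by blast
  have "immortal_set 1 G {v}"
    using u v neighbors_sym[OF u] neighbors_subset_verts
    by (intro immortal_setI[of _ "{u}"]) auto
  then have "MI 1 G \<le> 1" using MI_le_card by fastforce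
  then show ?thesis using MI_ge[OF assms(1) _ assms(2)] by simp
qed

end

theorem theorem8:
  fixes G :: "('a, 'b) pre_digraph" and r n :: nat and x :: real
  assumes "graph G"
    and "Digraph_Component.connected G"
    and "n = card (verts G)"
    and "1 \<le> r" and "r \<le> min_degree G"
    and "x = (if odd n then 0 else 1)"
  shows "(r = 1 \<longrightarrow> MI r G = 1) \<and>
         (r = 2 \<longrightarrow> 2 \<le> MI r G \<and> real (MI r G) \<le> real n / (1 + x)) \<and>
         (3 \<le> r \<longrightarrow> r \<le> MI r G \<and> MI r G \<le> n)"
proof -
  interpret graph G by fact
  have ne: "verts G \<noteq> {}"
    using assms(2) by (auto simp: connected_def strongly_connected_def)
  have ge: "r \<le> MI r G" using MI_ge[OF ne] assms by blast
  have le: "MI r G \<le> n" using MI_le_card[OF verts_immortal[OF ne]] assms by simp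
  have "real (MI r G) \<le> real n / (1 + x)" if "r = 2"
  proof (cases "even n")
    case True
    then have "2 * MI r G \<le> n" using MI_2_le_half_even[OF assms(2) ne] assms that by simp
    then show ?thesis using True assms(6) by simp
  next
    case False
    then show ?thesis using le assms(6) by simp
  qed
  then show ?thesis using ge le MI_1_eq_1[OF ne] assms by auto
qed

end
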